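(* Consider the unconstrained minimization over $\mathbf{x}\in\mathbb{R}^n$ of $$f(\mathbf{x};\theta)=\tfrac12\mathbf{x}^TG\mathbf{x}+\theta(\omega)^T\mathbf{x},$$ where $G\in\mathbb{R}^{n\times n}$ is positive definite and $\theta=\theta(\omega)$ is a random vector in $\mathbb{R}^n$. Then the first-order approximation method for the covariance of the solution (described in the context) has zero error; that is, the covariance matrix $\mathcal{T}\,\mathrm{Cov}(\theta)\,\mathcal{T}^T$ it yields is exactly the covariance matrix of the minimizer $\mathbf{x}^*(\theta)$.
   Context: First-order approximation method for the minimization of $f(\mathbf{x};\theta)$: let $\hat\theta$ be the mean of $\theta$ and $\mathbf{x}^*$ the minimizer for $\theta=\hat\theta$. Put $\mathcal{H}=\nabla^2_{\mathbf{x}}f(\mathbf{x}^*;\hat\theta)$ and $\mathcal{J}=\nabla_\theta\nabla_{\mathbf{x}}f(\mathbf{x}^*;\hat\theta)$. A perturbation $\Delta\theta$ of the parameters is taken to change the solution by $\Delta\mathbf{x}=-\mathcal{T}\Delta\theta$, where $\mathcal{H}\mathcal{T}=\mathcal{J}$, and the covariance of the solution is approximated by $\mathcal{T}\,\mathrm{Cov}(\theta)\,\mathcal{T}^T$. Positive definite matrices are symmetric. *)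

theory Defs
  imports "HOL-Probability.Probability"
begin

definition positive_definite :: "real^'n^'n \<Rightarrow> bool" where
  "positive_definite G \<longleftrightarrow> transpose G = G \<and> (\<forall>x. x \<noteq> 0 \<longrightarrow> x \<bullet> (G *v x) > 0)"

text \<open>Finite second moments are exactly what is needed for the mean vector and the covariance
  matrix to exist (outside this case Bochner integrals default to 0).\<close>

definition square_integrable_rv :: "'w measure \<Rightarrow> ('w \<Rightarrow> real^'n) \<Rightarrow> bool" where
  "square_integrable_rv M X \<longleftrightarrow>
     X \<in> borel_measurable M \<and> (\<forall>i. integrable M (\<lambda>\<omega>. (X \<omega> $ i)\<^sup>2))"

definition mean :: "'w measure \<Rightarrow> ('w \<Rightarrow> real^'n) \<Rightarrow> real^'n" where
  "mean M X = (\<integral>\<omega>. X \<omega> \<partial>M)"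

definition Cov :: "'w measure \<Rightarrow> ('w \<Rightarrow> real^'n) \<Rightarrow> real^'n^'n" where
  "Cov M X = (\<chi> i j. \<integral>\<omega>. (X \<omega> $ i - mean M X $ i) * (X \<omega> $ j - mean M X $ j) \<partial>M)"

text \<open>In the following a parametrised objective \<open>f x t\<close> takes the decision variable \<open>x\<close>
  first and the parameter \<open>t\<close> second.\<close>

definition is_minimizer :: "(real^'n \<Rightarrow> real^'m \<Rightarrow> real) \<Rightarrow> real^'m \<Rightarrow> real^'n \<Rightarrow> bool" where
  "is_minimizer f t x \<longleftrightarrow> is_arg_min (\<lambda>y. f y t) (\<lambda>_. True) x"

definition minimizer :: "(real^'n \<Rightarrow> real^'m \<Rightarrow> real) \<Rightarrow> real^'m \<Rightarrow> real^'n" where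
  "minimizer f t = (THE x. is_minimizer f t x)"

definition gradient :: "(real^'n \<Rightarrow> real) \<Rightarrow> real^'n \<Rightarrow> real^'n" where
  "gradient g x = (THE D. GDERIV g x :> D)"

definition hessian_x :: "(real^'n \<Rightarrow> real^'m \<Rightarrow> real) \<Rightarrow> real^'n \<Rightarrow> real^'m \<Rightarrow> real^'n^'n" where
  "hessian_x f x t = jacobian (gradient (\<lambda>z. f z t)) (at x)"

text \<open>The entry in row \<open>i\<close> and column \<open>j\<close> is the derivative with respect to \<open>t $ j\<close> of the
  partial derivative of \<open>f\<close> with respect to \<open>x $ i\<close>.\<close>

definition mixed_jacobian ::
    "(real^'n \<Rightarrow> real^'m \<Rightarrow> real) \<Rightarrow> real^'n \<Rightarrow> real^'m \<Rightarrow> real^'m^'n" where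
  "mixed_jacobian f x t = jacobian (\<lambda>s. gradient (\<lambda>z. f z s) x) (at t)"

definition is_first_order_matrix ::
    "(real^'n \<Rightarrow> real^'m \<Rightarrow> real) \<Rightarrow> real^'m \<Rightarrow> real^'m^'n \<Rightarrow> bool" where
  "is_first_order_matrix f t\<^sub>0 T \<longleftrightarrow>
     hessian_x f (minimizer f t\<^sub>0) t\<^sub>0 ** T = mixed_jacobian f (minimizer f t\<^sub>0) t\<^sub>0"

definition quadratic_objective :: "real^'n^'n \<Rightarrow> real^'n \<Rightarrow> real^'n \<Rightarrow> real" where
  "quadratic_objective G x t = 1/2 * (x \<bullet> (G *v x)) + t \<bullet> x"

end

theory Submission
  imports Defs
begin

text \<open>By convexity the minimizer for parameter \<open>t\<close> is the unique critical point, that is, the solution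
  \<open>- G\<^sup>-\<^sup>1 t\<close> of \<open>G x + t = 0\<close>. The Hessian is \<open>G\<close> and the mixed Jacobian is the identity, so
  \<open>T = G\<^sup>-\<^sup>1\<close>. The solution is thus exactly linear in the parameter, with matrix \<open>- T\<close>, and the
  covariance of a linear image \<open>A X\<close> is \<open>A Cov(X) A\<^sup>T\<close>.\<close>

section \<open>Random vectors with finite second moments\<close>

lemma borel_measurable_vec_nth [measurable (raw)]:
  fixes X :: "'w \<Rightarrow> real^'n"
  assumes "X \<in> borel_measurable M"
  shows "(\<lambda>\<omega>. X \<omega> $ i) \<in> borel_measurable M"
proof -
  have "(\<lambda>x :: real^'n. x $ i) \<in> borel_measurable borel"
    by (intro borel_measurable_continuous_onI linear_continuous_on bounded_linear_vec_nth)
  with assms show ?thesis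
    by (rule measurable_compose)
qed

text \<open>The sum of the two squared components dominates the product, so all mixed second moments
  exist.\<close>

lemma square_integrable_rv_integrable_mult:
  assumes "square_integrable_rv M X" and "square_integrable_rv M Y"
  shows "integrable M (\<lambda>\<omega>. X \<omega> $ i * Y \<omega> $ j)"
proof (rule Bochner_Integration.integrable_bound)
  show "integrable M (\<lambda>\<omega>. (X \<omega> $ i)\<^sup>2 + (Y \<omega> $ j)\<^sup>2)"
    using assms by (simp add: square_integrable_rv_def)
  have [measurable]: "X \<in> borel_measurable M" "Y \<in> borel_measurable M"
    using assms by (simp_all add: square_integrable_rv_def)
  show "(\<lambda>\<omega>. X \<omega> $ i * Y \<omega> $ j) \<in> borel_measurable M" by measurable
  \<comment> \<open>From \<open>2 * \<bar>a\<bar> * \<bar>b\<bar> \<le> a\<^sup>2 +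
    b\<^sup>2\<close>, where nonnegativity of the product allows the factor 2 to be dropped. The
    simp rule is removed so that it does not reduce the inserted nonnegativity fact to
    \<open>True\<close>.\<close>
  have "\<bar>a * b\<bar> \<le> a\<^sup>2 + b\<^sup>2" for a b :: real
    using sum_squares_bound[of "\<bar>a\<bar>" "\<bar>b\<bar>"] mult_nonneg_nonneg[of "\<bar>a\<bar>" "\<bar>b\<bar>"]
    by (simp add: abs_mult mult.assoc del: mult_nonneg_nonneg)
  then show "AE \<omega> in M. norm (X \<omega> $ i * Y \<omega> $ j) \<le> norm ((X \<omega> $ i)\<^sup>2 + (Y \<omega> $ j)\<^sup>2)"
    by simp
qed

text \<open>A squared component of the image is a finite linear combination of products of two
  components of \<open>X\<close>.\<close>

lemma square_integrable_rv_matrix_vector_mult: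
  fixes A :: "real^'n^'m"
  assumes "square_integrable_rv M X"
  shows "square_integrable_rv M (\<lambda>\<omega>. A *v X \<omega>)"
proof -
  have "(\<lambda>x. A *v x) \<in> borel_measurable borel"
    by (intro borel_measurable_continuous_onI linear_continuous_on matrix_vector_mul_bounded_linear)
  then have "(\<lambda>\<omega>. A *v X \<omega>) \<in> borel_measurable M"
    using assms unfolding square_integrable_rv_def by (blast intro: measurable_compose)
  moreover have "integrable M (\<lambda>\<omega>. ((A *v X \<omega>) $ i)\<^sup>2)" for i
  proof -
    have "((A *v X \<omega>) $ i)\<^sup>2
        = (\<Sum>k\<in>UNIV. \<Sum>l\<in>UNIV. A $ i $ k * A $ i $ l * (X \<omega> $ k * X \<omega> $ l))" for \<omega>
      by (simp add: matrix_vector_mult_def power2_eq_square sum_product mult_ac)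
    then show ?thesis
      using square_integrable_rv_integrable_mult[OF assms assms] by simp
  qed
  ultimately show ?thesis
    by (simp add: square_integrable_rv_def)
qed

lemma square_integrable_rv_imp_integrable_nth:
  assumes "finite_measure M" and "square_integrable_rv M X"
  shows "integrable M (\<lambda>\<omega>. X \<omega> $ i)"
  using assms(2) unfolding square_integrable_rv_def
  by (blast intro: finite_measure.square_integrable_imp_integrable[OF assms(1)]
      borel_measurable_vec_nth)

text \<open>The Euclidean norm is at most the sum of the absolute components. Integrability of the
  whole vector lets the Bochner integral commute with a matrix.\<close>

lemma square_integrable_rv_imp_integrable:
  assumes "finite_measure M" and "square_integrable_rv M X"
  shows "integrable M X"
proof -
  have X [measurable]: "X \<in> borel_measurable M"
    using assms by (simp add: square_integrable_rv_def)
  have "integrable M (\<lambda>\<omega>. X \<omega> $ i)" for i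
    using assms by (rule square_integrable_rv_imp_integrable_nth)
  then have "integrable M (\<lambda>\<omega>. \<Sum>i\<in>UNIV. \<bar>X \<omega> $ i\<bar>)"
    by simp
  then show ?thesis
  proof (rule Bochner_Integration.integrable_bound[OF _ X])
    show "AE \<omega> in M. norm (X \<omega>) \<le> norm (\<Sum>i\<in>UNIV. \<bar>X \<omega> $ i\<bar>)"
      by (intro AE_I2) (simp add: norm_le_l1_cart sum_nonneg)
  qed
qed

text \<open>Expanding the square leaves a linear and a constant term, both integrable over a finite
  measure. The case of interest is centring, with \<open>c\<close> the mean.\<close>

lemma square_integrable_rv_diff_const:
  assumes "finite_measure M" and "square_integrable_rv M X"
  shows "square_integrable_rv M (\<lambda>\<omega>. X \<omega> - c)"
proof -
  interpret finite_measure M by fact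
  have X [measurable]: "X \<in> borel_measurable M"
    using assms by (simp add: square_integrable_rv_def)
  have "integrable M (\<lambda>\<omega>. X \<omega> $ i)" for i
    using assms by (rule square_integrable_rv_imp_integrable_nth)
  then show ?thesis
    using assms by (simp add: square_integrable_rv_def power2_diff)
qed

section \<open>Mean and covariance of a linear image\<close>

lemma mean_matrix_vector_mult:
  fixes A :: "real^'n^'m"
  assumes "integrable M X"
  shows "mean M (\<lambda>\<omega>. A *v X \<omega>) = A *v mean M X"
  unfolding mean_def
  by (rule integral_bounded_linear[OF matrix_vector_mul_bounded_linear assms])

lemma Cov_matrix_vector_mult:
  fixes A :: "real^'n^'m"
  assumes "finite_measure M" and "square_integrable_rv M X"
  shows "Cov M (\<lambda>\<omega>. A *v X \<omega>) = A ** Cov M X ** transpose A"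
proof -
  let ?Y = "\<lambda>\<omega>. X \<omega> - mean M X"
  have Y: "square_integrable_rv M ?Y"
    using assms by (rule square_integrable_rv_diff_const)
  have Y_mult: "integrable M (\<lambda>\<omega>. (X \<omega> $ k - mean M X $ k) * (X \<omega> $ l - mean M X $ l))" for k l
    using square_integrable_rv_integrable_mult[OF Y Y, of k l] by simp
  have *: "((A *v X \<omega>) $ i - (A *v mean M X) $ i) * ((A *v X \<omega>) $ j - (A *v mean M X) $ j)
      = (\<Sum>l\<in>UNIV. \<Sum>k\<in>UNIV. A $ i $ k * A $ j $ l
          * ((X \<omega> $ k - mean M X $ k) * (X \<omega> $ l - mean M X $ l)))" for \<omega> i j
  proof -
    have "((A *v X \<omega>) $ i - (A *v mean M X) $ i) * ((A *v X \<omega>) $ j - (A *v mean M X) $ j)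
        = (A *v ?Y \<omega>) $ i * (A *v ?Y \<omega>) $ j"
      by (simp add: matrix_vector_mult_diff_distrib)
    also have "\<dots> = (\<Sum>k\<in>UNIV. \<Sum>l\<in>UNIV. A $ i $ k * A $ j $ l
          * ((X \<omega> $ k - mean M X $ k) * (X \<omega> $ l - mean M X $ l)))"
      by (simp add: matrix_vector_mult_def sum_product mult_ac)
    \<comment> \<open>The swap makes the summation order match the unfolding of
      \<open>A ** Cov M X ** transpose A\<close>, whose outer sum runs over the index of the right
      factor.\<close>
    finally show ?thesis
      by (subst sum.swap)
  qed
  have "mean M (\<lambda>\<omega>. A *v X \<omega>) = A *v mean M X"
    using assms by (intro mean_matrix_vector_mult square_integrable_rv_imp_integrable)
  then show ?thesis
    using Y_mult
    by (simp add: Cov_def vec_eq_iff * matrix_matrix_mult_def transpose_def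
        sum_distrib_right sum_distrib_left mult_ac)
qed

section \<open>Linear algebra and calculus of the quadratic objective\<close>

lemma positive_definite_imp_invertible:
  assumes "positive_definite G"
  shows "invertible G"
proof -
  \<comment> \<open>A nonzero kernel vector would give \<open>x \<bullet> (G *v x) = 0\<close>,
    against definiteness.\<close>
  have "x = 0" if "G *v x = 0" for x
    using assms that unfolding positive_definite_def
    by (metis inner_zero_right less_irrefl)
  then show ?thesis
    by (simp add: invertible_left_inverse matrix_left_invertible_ker)
qed

lemma inner_matrix_vector_mult_symmetric:
  fixes G :: "real^'n^'n"
  assumes "transpose G = G"
  shows "x \<bullet> (G *v y) = y \<bullet> (G *v x)"
  by (metis assms dot_lmul_matrix inner_commute transpose_matrix_vector)

text \<open>This is the exact second-order Taylor expansion; symmetry merges the two cross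
  terms.\<close>

lemma quadratic_objective_expand:
  assumes "transpose G = G"
  shows "quadratic_objective G (x + h) t
    = quadratic_objective G x t + (G *v x + t) \<bullet> h + 1/2 * (h \<bullet> (G *v h))"
  using inner_matrix_vector_mult_symmetric[OF assms, of x h]
  by (simp add: quadratic_objective_def matrix_vector_right_distrib inner_add_left inner_add_right
      inner_commute[of "G *v x" h] field_simps)

lemma gderiv_quadratic_objective:
  assumes "transpose G = G"
  shows "GDERIV (\<lambda>z. quadratic_objective G z t) x :> G *v x + t"
proof -
  have "((\<lambda>z. quadratic_objective G z t) has_derivative
      (\<lambda>h. 1/2 * (x \<bullet> (G *v h) + h \<bullet> (G *v x)) + t \<bullet> h)) (at x)"
    unfolding quadratic_objective_def
    by (auto intro!: derivative_eq_intros
        bounded_linear.has_derivative[OF matrix_vector_mul_bounded_linear])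
  moreover have "1/2 * (x \<bullet> (G *v h) + h \<bullet> (G *v x)) + t \<bullet> h = h \<bullet> (G *v x + t)" for h
    using inner_matrix_vector_mult_symmetric[OF assms, of x h]
    by (simp add: inner_add_right inner_commute[of t h])
  ultimately show ?thesis
    by (simp add: gderiv_def)
qed

text \<open>Derivatives are unique and a vector is determined by its inner products, so the definite
  description is well defined.\<close>

lemma gradient_eq:
  assumes "GDERIV g x :> D"
  shows "gradient g x = D"
proof -
  have "E = D" if "GDERIV g x :> E" for E
  proof -
    have "(\<lambda>h. h \<bullet> E) = (\<lambda>h. h \<bullet> D)"
      using that assms unfolding gderiv_def by (rule has_derivative_unique)
    then have "\<forall>h. h \<bullet> E = h \<bullet> D"
      by (simp add: fun_eq_iff)
    then show ?thesis
      by (simp only: vector_eq_ldot)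
  qed
  with assms show ?thesis
    unfolding gradient_def by blast
qed

lemma jacobian_eq:
  fixes A :: "real^'n^'m"
  assumes "(f has_derivative (*v) A) (at x)"
  shows "jacobian f (at x) = A"
  by (simp add: jacobian_def frechet_derivative_at[OF assms, symmetric])

lemma hessian_x_quadratic_objective:
  assumes "transpose G = G"
  shows "hessian_x (quadratic_objective G) x t = G"
proof -
  have "((\<lambda>x. G *v x + t) has_derivative (*v) G) (at x)"
    by (auto intro!: derivative_eq_intros
        bounded_linear.has_derivative[OF matrix_vector_mul_bounded_linear])
  \<comment> \<open>The gradient is identified as a function of the point, since the Hessian
    differentiates it.\<close>
  moreover have "gradient (\<lambda>z. quadratic_objective G z t) = (\<lambda>x. G *v x + t)"
    by (intro ext gradient_eq gderiv_quadratic_objective assms)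
  ultimately show ?thesis
    by (simp add: hessian_x_def jacobian_eq)
qed

text \<open>The parameter enters the gradient only as a translation.\<close>

lemma mixed_jacobian_quadratic_objective:
  assumes "transpose G = G"
  shows "mixed_jacobian (quadratic_objective G) x t = mat 1"
proof -
  have "((\<lambda>s. G *v x + s) has_derivative (*v) (mat 1)) (at t)"
    by (auto intro!: derivative_eq_intros)
  then show ?thesis
    by (simp add: mixed_jacobian_def gradient_eq[OF gderiv_quadratic_objective[OF assms]] jacobian_eq)
qed

text \<open>A minimizer has zero gradient. Conversely, at a critical point the Taylor expansion has
  no linear term and its quadratic term is nonnegative.\<close>

lemma is_minimizer_quadratic_objective_iff:
  assumes "positive_definite G"
  shows "is_minimizer (quadratic_objective G) t x \<longleftrightarrow> G *v x + t = 0"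
proof -
  have sym: "transpose G = G"
    using assms by (simp add: positive_definite_def)
  have nonneg: "h \<bullet> (G *v h) \<ge> 0" for h
    using assms by (cases "h = 0") (auto simp: positive_definite_def less_imp_le)
  have min: "is_minimizer (quadratic_objective G) t x
      \<longleftrightarrow> (\<forall>y. quadratic_objective G x t \<le> quadratic_objective G y t)"
    by (auto simp: is_minimizer_def is_arg_min_linorder)
  show ?thesis
  proof
    assume "is_minimizer (quadratic_objective G) t x"
    then have "(\<lambda>h. h \<bullet> (G *v x + t)) = (\<lambda>h. 0)"
      using gderiv_quadratic_objective[OF sym, of t x] unfolding gderiv_def min
      by (intro has_derivative_local_min[of "\<lambda>z. quadratic_objective G z t" _ x]) auto
    \<comment> \<open>The vanishing derivative is evaluated in the direction of the gradient
      itself.\<close>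
    then have "(G *v x + t) \<bullet> (G *v x + t) = 0"
      by (rule fun_cong)
    then show "G *v x + t = 0"
      by simp
  next
    assume "G *v x + t = 0"
    then have "quadratic_objective G x t \<le> quadratic_objective G y t" for y
      using quadratic_objective_expand[OF sym, of x "y - x" t] nonneg[of "y - x"] by simp
    then show "is_minimizer (quadratic_objective G) t x"
      by (simp add: min)
  qed
qed

theorem corollary17:
  fixes M :: "'w measure"
    and \<theta> :: "'w \<Rightarrow> real^'n"
    and G :: "real^'n^'n"
  assumes "prob_space M"
    and "square_integrable_rv M \<theta>"
    and "positive_definite G"
  shows "(\<forall>t. \<exists>!x. is_minimizer (quadratic_objective G) t x)
    \<and> square_integrable_rv M (\<lambda>\<omega>. minimizer (quadratic_objective G) (\<theta> \<omega>))
    \<and> (\<exists>!T. is_first_order_matrix (quadratic_objective G) (mean M \<theta>) T)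
    \<and> (\<forall>T. is_first_order_matrix (quadratic_objective G) (mean M \<theta>) T \<longrightarrow>
          T ** Cov M \<theta> ** transpose T
            = Cov M (\<lambda>\<omega>. minimizer (quadratic_objective G) (\<theta> \<omega>)))"
proof -
  interpret prob_space M by fact
  have sym: "transpose G = G"
    using assms(3) by (simp add: positive_definite_def)
  obtain B where GB: "G ** B = mat 1" and BG: "B ** G = mat 1"
    using positive_definite_imp_invertible[OF assms(3)] by (auto simp: invertible_def)
  have minus_B: "(- B) *v y = - (B *v y)" for y
    by (simp add: vec_eq_iff matrix_vector_mult_def sum_negf)
  have BG_vec: "B *v (G *v y) = y" and GB_vec: "G *v (B *v y) = y" for y
    by (simp_all add: matrix_vector_mul_assoc BG GB)
  have solve: "G *v x + t = 0 \<longleftrightarrow> x = (- B) *v t" for x t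
  proof
    assume "G *v x + t = 0"
    then have "t = G *v (- x)"
      by (simp add: eq_neg_iff_add_eq_0 add.commute vec.neg)
    then show "x = (- B) *v t"
      by (simp only: minus_B BG_vec minus_minus)
  next
    assume "x = (- B) *v t"
    then show "G *v x + t = 0"
      by (simp only: minus_B vec.neg GB_vec left_minus)
  qed
  \<comment> \<open>This gives existence and uniqueness at once, and hence the value of
    \<open>minimizer\<close>.\<close>
  have is_min: "is_minimizer (quadratic_objective G) t x \<longleftrightarrow> x = (- B) *v t" for x t
    using is_minimizer_quadratic_objective_iff[OF assms(3)] solve by simp
  then have minimizer: "minimizer (quadratic_objective G) t = (- B) *v t" for t
    by (simp add: minimizer_def)
  \<comment> \<open>Hessian and mixed Jacobian are constant, so \<open>T\<close> is the same at
    every \<open>t\<close>, in particular at the mean. Multiplying \<open>G ** T = mat 1\<close> by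
    \<open>B\<close> on the left yields \<open>T = B\<close>.\<close>
  have first_order: "is_first_order_matrix (quadratic_objective G) t T \<longleftrightarrow> T = B" for t T
  proof -
    have "is_first_order_matrix (quadratic_objective G) t T \<longleftrightarrow> G ** T = mat 1"
      by (simp add: is_first_order_matrix_def hessian_x_quadratic_objective[OF sym]
          mixed_jacobian_quadratic_objective[OF sym])
    also have "\<dots> \<longleftrightarrow> T = B"
      by (metis GB BG matrix_mul_assoc matrix_mul_lid matrix_mul_rid)
    finally show ?thesis .
  qed
  have "Cov M (\<lambda>\<omega>. (- B) *v \<theta> \<omega>) = (- B) ** Cov M \<theta> ** transpose (- B)"
    using finite_measure_axioms assms(2) by (rule Cov_matrix_vector_mult)
  \<comment> \<open>The solution map is \<open>- B\<close> while \<open>T\<close> is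
    \<open>B\<close>; the two signs cancel because the matrix occurs twice.\<close>
  also have "\<dots> = B ** Cov M \<theta> ** transpose B"
    by (simp add: vec_eq_iff matrix_matrix_mult_def transpose_def sum_negf)
  finally show ?thesis
    using square_integrable_rv_matrix_vector_mult[OF assms(2), of "- B"]
    by (simp add: is_min minimizer first_order)
qed

end
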